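(* Let $d\ge 2$ and let $H=\Pi_S=(I+V)/2$ on $\mathbb{C}^d\otimes\mathbb{C}^d$, where $V$ is the swap operator, $V|\psi\rangle|\phi\rangle=|\phi\rangle|\psi\rangle$. Then the total energy range of $H$ is $E_{\mathrm{tot}}=1$, its entanglement gap is $G_E=1/2$ (independent of $d$), and its scaled entanglement-gap temperature is $$t_E=\left[\log_e\left(\frac{d+1}{d-1}\right)\right]^{-1}.$$ In particular $t_E\simeq d/2$ for $d\gg1$, so $t_E$ increases without bound as $d\to\infty$.
   Context: A density operator on $\mathcal{H}_A\otimes\mathcal{H}_B$ is separable if it is a convex combination of pure product states; $\mathcal{S}$ is the set of separable states. For a Hamiltonian $H$ with smallest and largest eigenvalues $E_0,E_{\max}$: $E_{\mathrm{tot}}=E_{\max}-E_0$, $E_{\mathrm{sep}}=\min_{\rho\in\mathcal{S}}\mathrm{tr}[H\rho]$, and the entanglement gap is $G_E=E_{\mathrm{sep}}-E_0$. The thermal state at temperature $T>0$ is $\rho_T=e^{-\beta H}/\mathrm{tr}[e^{-\beta H}]$ with $\beta=1/(k_BT)$, and the thermal energy is $U(T)=\mathrm{tr}[H\rho_T]$. If $G_E>0$, the entanglement-gap temperature $T_E$ is the temperature with $U(T_E)=E_{\mathrm{sep}}$, and the scaled entanglement-gap temperature is $t_E=k_BT_E/E_{\mathrm{tot}}$. *)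

theory Defs
  imports
    "HOL-Library.Landau_Symbols"
    "Jordan_Normal_Form.Char_Poly"
begin

(* C^m (x) C^n is identified with C^(m * n): the basis vector |i>|j> is the
   standard basis vector with index i * n + j. *)

definition tensor_vec :: "complex vec \<Rightarrow> complex vec \<Rightarrow> complex vec" where
  "tensor_vec \<psi> \<phi> = vec (dim_vec \<psi> * dim_vec \<phi>)
     (\<lambda>k. \<psi> $ (k div dim_vec \<phi>) * \<phi> $ (k mod dim_vec \<phi>))"

definition rank1_proj :: "complex vec \<Rightarrow> complex mat" where
  "rank1_proj v = mat (dim_vec v) (dim_vec v) (\<lambda>(r, c). v $ r * cnj (v $ c))"

definition unit_vecs :: "nat \<Rightarrow> complex vec set" where
  "unit_vecs n = {v \<in> carrier_vec n. v \<bullet>c v = 1}"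

definition tr :: "complex mat \<Rightarrow> complex" where
  "tr A = (\<Sum>i<dim_row A. A $$ (i, i))"

(* Every convex combination of projections onto unit vectors is positive
   semidefinite with trace 1, so being a density operator is not required separately.
   The sum of matrices is taken entrywise: complex mat is not a monoid type. *)
definition separable_states :: "nat \<Rightarrow> nat \<Rightarrow> complex mat set" where
  "separable_states dA dB =
     {\<rho>. \<exists>(N::nat) (p :: nat \<Rightarrow> real) \<psi> \<phi>.
        (\<forall>k<N. 0 \<le> p k \<and> \<psi> k \<in> unit_vecs dA \<and> \<phi> k \<in> unit_vecs dB) \<and>
        (\<Sum>k<N. p k) = 1 \<and>
        \<rho> = mat (dA * dB) (dA * dB)
              (\<lambda>(r, c). \<Sum>k<N. complex_of_real (p k) *
                 rank1_proj (tensor_vec (\<psi> k) (\<phi> k)) $$ (r, c))}"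

(* Hamiltonians are Hermitian, so all their eigenvalues are real. *)
definition energies :: "complex mat \<Rightarrow> real set" where
  "energies H = {e. eigenvalue H (complex_of_real e)}"

definition E_min :: "complex mat \<Rightarrow> real" where
  "E_min H = Min (energies H)"

definition E_max :: "complex mat \<Rightarrow> real" where
  "E_max H = Max (energies H)"

definition E_tot :: "complex mat \<Rightarrow> real" where
  "E_tot H = E_max H - E_min H"

(* LEAST rather than Inf: the minimum over the separable states, which is attained. *)
definition E_sep :: "nat \<Rightarrow> nat \<Rightarrow> complex mat \<Rightarrow> real" where
  "E_sep dA dB H = (LEAST e. \<exists>\<rho>\<in>separable_states dA dB. e = Re (tr (H * \<rho>)))"

definition ent_gap :: "nat \<Rightarrow> nat \<Rightarrow> complex mat \<Rightarrow> real" where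
  "ent_gap dA dB H = E_sep dA dB H - E_min H"

definition mat_exp :: "complex mat \<Rightarrow> complex mat" where
  "mat_exp A = mat (dim_row A) (dim_col A) (\<lambda>(i, j). \<Sum>k. (A ^\<^sub>m k) $$ (i, j) / fact k)"

definition thermal_state :: "real \<Rightarrow> complex mat \<Rightarrow> real \<Rightarrow> complex mat" where
  "thermal_state kB H T =
     (let \<beta> = 1 / (kB * T); W = mat_exp (complex_of_real (- \<beta>) \<cdot>\<^sub>m H)
      in (1 / tr W) \<cdot>\<^sub>m W)"

definition thermal_energy :: "real \<Rightarrow> complex mat \<Rightarrow> real \<Rightarrow> real" where
  "thermal_energy kB H T = Re (tr (H * thermal_state kB H T))"

definition is_ent_gap_temp ::
    "real \<Rightarrow> nat \<Rightarrow> nat \<Rightarrow> complex mat \<Rightarrow> real \<Rightarrow> bool" where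
  "is_ent_gap_temp kB dA dB H T \<longleftrightarrow> 0 < T \<and> thermal_energy kB H T = E_sep dA dB H"

(* Only meaningful when the entanglement gap is positive. *)
definition ent_gap_temp :: "real \<Rightarrow> nat \<Rightarrow> nat \<Rightarrow> complex mat \<Rightarrow> real" where
  "ent_gap_temp kB dA dB H = (THE T. is_ent_gap_temp kB dA dB H T)"

definition scaled_ent_gap_temp :: "real \<Rightarrow> nat \<Rightarrow> nat \<Rightarrow> complex mat \<Rightarrow> real" where
  "scaled_ent_gap_temp kB dA dB H = kB * ent_gap_temp kB dA dB H / E_tot H"

definition swap_op :: "nat \<Rightarrow> complex mat" where
  "swap_op d = mat (d * d) (d * d)
     (\<lambda>(r, c). if r div d = c mod d \<and> r mod d = c div d then 1 else 0)"

lemma swap_op_tensor_vec: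
  assumes "\<psi> \<in> carrier_vec d" "\<phi> \<in> carrier_vec d"
  shows "swap_op d *\<^sub>v tensor_vec \<psi> \<phi> = tensor_vec \<phi> \<psi>"
proof (rule eq_vecI)
  show "dim_vec (swap_op d *\<^sub>v tensor_vec \<psi> \<phi>) = dim_vec (tensor_vec \<phi> \<psi>)"
    using assms by (simp add: swap_op_def tensor_vec_def)
next
  fix r assume "r < dim_vec (tensor_vec \<phi> \<psi>)"
  hence r: "r < d * d" using assms by (simp add: tensor_vec_def)
  hence d: "d > 0" by (cases d) auto
  define s where "s = (r mod d) * d + r div d"
  have rd: "r div d < d" "r mod d < d"
    using r d by (auto simp: less_mult_imp_div_less)
  have sdiv: "s div d = r mod d" and smod: "s mod d = r div d"
    using rd by (auto simp: s_def)
  have "s < (r mod d) * d + d" using rd by (simp add: s_def)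
  also have "\<dots> = Suc (r mod d) * d" by simp
  also have "\<dots> \<le> d * d" using rd by (intro mult_right_mono) (auto simp: Suc_le_eq)
  finally have s: "s < d * d" .
  have iff: "(r div d = c mod d \<and> r mod d = c div d) \<longleftrightarrow> c = s" for c
    using sdiv smod by (metis div_mult_mod_eq)
  have "(swap_op d *\<^sub>v tensor_vec \<psi> \<phi>) $ r =
      (\<Sum>c\<in>{0..<d * d}. (if c = s then 1 else 0) * (\<psi> $ (c div d) * \<phi> $ (c mod d)))"
    using r assms
    by (simp add: swap_op_def tensor_vec_def scalar_prod_def iff)
  also have "\<dots> = \<psi> $ (s div d) * \<phi> $ (s mod d)"
    using s by (simp add: if_distrib[where f = "\<lambda>x. x * _"] cong: if_cong)
  also have "\<dots> = tensor_vec \<phi> \<psi> $ r"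
    using r assms by (simp add: tensor_vec_def sdiv smod)
  finally show "(swap_op d *\<^sub>v tensor_vec \<psi> \<phi>) $ r = tensor_vec \<phi> \<psi> $ r" .
qed

definition sym_proj :: "nat \<Rightarrow> complex mat" where
  "sym_proj d = (1 / 2) \<cdot>\<^sub>m (1\<^sub>m (d * d) + swap_op d)"

end

theory Submission
  imports Defs "HOL-Real_Asymp.Real_Asymp"
begin

text \<open>
  The swap \<open>V\<close> is an involution, so \<open>P = (I + V)/2\<close> is idempotent and its energies are 0 and 1.
  On a product vector the expectation of \<open>P\<close> is \<open>(1 + |\<langle>\<psi>|\<phi>\<rangle>|\<^sup>2)/2\<close>, which is at least
  \<open>1/2\<close>, with equality for orthogonal factors.  Idempotence also gives
  \<open>exp(cP) = I + (e\<^sup>c - 1)P\<close>; with \<open>t = tr P = d(d+1)/2\<close> and \<open>x = e\<^bsup>-\<beta>\<^esup>\<close> the thermal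
  energy is \<open>xt/(d\<^sup>2 - t + xt)\<close>, which equals \<open>1/2\<close> exactly when \<open>x = (d-1)/(d+1)\<close>.
\<close>

section \<open>The swap operator\<close>

text \<open>The index permutation \<open>i * d + j\<close> -> \<open>j * d + i\<close> that
  exchanges the two tensor factors. \<open>swap_op d\<close> is its permutation matrix, so sums
  along a row collapse to a single term.\<close>

definition swap_index :: "nat \<Rightarrow> nat \<Rightarrow> nat" where
  "swap_index d r = (r mod d) * d + r div d"

lemma
  assumes "r < d * d"
  shows swap_index_div: "swap_index d r div d = r mod d"
    and swap_index_mod: "swap_index d r mod d = r div d"
    and swap_index_less: "swap_index d r < d * d"
    and swap_index_swap_index: "swap_index d (swap_index d r) = r"
proof -
  have d: "d > 0" using assms by (cases d) auto
  have rd: "r div d < d" "r mod d < d"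
    using assms d by (auto simp: less_mult_imp_div_less)
  show 1: "swap_index d r div d = r mod d" and 2: "swap_index d r mod d = r div d"
    using rd by (auto simp: swap_index_def)
  have "swap_index d r < Suc (r mod d) * d" using rd by (simp add: swap_index_def)
  also have "\<dots> \<le> d * d" using rd by (intro mult_right_mono) (auto simp: Suc_le_eq)
  finally show "swap_index d r < d * d" .
  show "swap_index d (swap_index d r) = r"
    by (subst swap_index_def) (simp add: 1 2)
qed

lemma swap_op_carrier [simp]: "swap_op d \<in> carrier_mat (d * d) (d * d)"
  by (simp add: swap_op_def)

lemma swap_op_index:
  assumes "r < d * d" "c < d * d"
  shows "swap_op d $$ (r, c) = (if c = swap_index d r then 1 else 0)"
proof -
  have "(r div d = c mod d \<and> r mod d = c div d) \<longleftrightarrow> c = swap_index d r"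
    using swap_index_div[OF assms(1)] swap_index_mod[OF assms(1)] by (metis div_mult_mod_eq)
  thus ?thesis using assms by (simp add: swap_op_def)
qed

text \<open>In row \<open>i\<close> of the product only \<open>k = swap_index d i\<close>
  contributes, and exchanging the factors a second time leads back to \<open>i\<close>.\<close>

lemma swap_op_square: "swap_op d * swap_op d = 1\<^sub>m (d * d)"
proof (rule eq_matI)
  fix i j assume "i < dim_row (1\<^sub>m (d * d) :: complex mat)" "j < dim_col (1\<^sub>m (d * d) :: complex mat)"
  hence ij: "i < d * d" "j < d * d" by auto
  have "(swap_op d * swap_op d) $$ (i, j) =
      (\<Sum>k\<in>{0..<d * d}. swap_op d $$ (i, k) * swap_op d $$ (k, j))"
    using ij carrier_matD[OF swap_op_carrier[of d]] by (simp add: scalar_prod_def)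
  also have "\<dots> = (\<Sum>k\<in>{0..<d * d}. if k = swap_index d i then swap_op d $$ (k, j) else 0)"
    using ij by (intro sum.cong) (auto simp: swap_op_index)
  also have "\<dots> = swap_op d $$ (swap_index d i, j)"
    using swap_index_less[OF ij(1)] by simp
  also have "\<dots> = 1\<^sub>m (d * d) $$ (i, j)"
    using ij swap_index_less[OF ij(1)] swap_index_swap_index[OF ij(1)]
    by (auto simp: swap_op_index)
  finally show "(swap_op d * swap_op d) $$ (i, j) = 1\<^sub>m (d * d) $$ (i, j)" .
qed (use carrier_matD[OF swap_op_carrier[of d]] in auto)

text \<open>Cut the range into \<open>m\<close> blocks of length \<open>n\<close>: on block
  \<open>i\<close> the quotient is constantly \<open>i\<close> and the remainder runs through all
  \<open>j < n\<close>. This turns sums over the index of a tensor product into double sums over its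
  factors.\<close>

lemma sum_div_mod:
  fixes f :: "nat \<Rightarrow> nat \<Rightarrow> 'a::comm_monoid_add"
  shows "(\<Sum>k<m * n. f (k div n) (k mod n)) = (\<Sum>i<m. \<Sum>j<n. f i j)"
proof -
  have "(\<Sum>k<m * n. f (k div n) (k mod n)) =
      (\<Sum>i<m. \<Sum>k\<in>{i * n..<i * n + n}. f (k div n) (k mod n))"
    by (rule sum.nat_group[symmetric])
  also have "\<dots> = (\<Sum>i<m. \<Sum>j<n. f i j)"
  proof (rule sum.cong[OF refl])
    fix i
    have "(\<Sum>k\<in>{i * n..<i * n + n}. f (k div n) (k mod n)) =
        (\<Sum>j\<in>{0..<n}. f ((j + i * n) div n) ((j + i * n) mod n))"
      using sum.shift_bounds_nat_ivl[of "\<lambda>k. f (k div n) (k mod n)" 0 "i * n" n]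
      by (simp add: add.commute)
    also have "\<dots> = (\<Sum>j<n. f i j)"
      by (intro sum.cong) auto
    finally show "(\<Sum>k\<in>{i * n..<i * n + n}. f (k div n) (k mod n)) = (\<Sum>j<n. f i j)" .
  qed
  finally show ?thesis .
qed

text \<open>A basis vector |i>|j> contributes to the diagonal only if i = j.\<close>

lemma tr_swap_op: "tr (swap_op d) = of_nat d"
proof -
  have "tr (swap_op d) = (\<Sum>k<d * d. if k div d = k mod d then 1 else 0)"
    unfolding tr_def by (intro sum.cong) (auto simp: swap_op_def)
  also have "\<dots> = (\<Sum>i<d. \<Sum>j<d. if i = j then 1 else 0)"
    by (rule sum_div_mod)
  also have "\<dots> = of_nat d" by simp
  finally show ?thesis .
qed

section \<open>The projection onto the symmetric subspace\<close>

lemma sym_proj_carrier [simp]: "sym_proj d \<in> carrier_mat (d * d) (d * d)"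
  by (simp add: sym_proj_def)

text \<open>Since V^2 = I, expanding gives (I + V)^2 = 2(I + V); the two factors 1/2 then leave a
  single one.\<close>

lemma sym_proj_idem: "sym_proj d * sym_proj d = sym_proj d"
proof -
  let ?I = "1\<^sub>m (d * d) :: complex mat" and ?V = "swap_op d"
  have S: "?I + ?V \<in> carrier_mat (d * d) (d * d)" by simp
  have "(?I + ?V) * (?I + ?V) = (?I * ?I + ?V * ?I) + (?I * ?V + ?V * ?V)"
    using S by (simp add: mult_add_distrib_mat[where nr = "d * d" and n = "d * d" and nc = "d * d"]
        add_mult_distrib_mat[where nr = "d * d" and n = "d * d" and nc = "d * d"])
  also have "\<dots> = 2 \<cdot>\<^sub>m (?I + ?V)"
    using carrier_matD[OF swap_op_carrier[of d]] right_mult_one_mat[OF swap_op_carrier[of d]]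
      left_mult_one_mat[OF swap_op_carrier[of d]]
    by (intro eq_matI) (auto simp: swap_op_square)
  finally have "(?I + ?V) * (?I + ?V) = 2 \<cdot>\<^sub>m (?I + ?V)" .
  thus ?thesis unfolding sym_proj_def
    using carrier_matD[OF swap_op_carrier[of d]]
    by (simp add: mult_smult_assoc_mat[OF S smult_carrier_mat[OF S]] mult_smult_distrib[OF S S])
       (intro eq_matI; auto)
qed

text \<open>This is the dimension of the symmetric subspace, which later counts the states of energy
  1 in the partition function.\<close>

lemma tr_sym_proj: "tr (sym_proj d) = of_nat (d * (d + 1)) / 2"
proof -
  have "tr (sym_proj d) = (\<Sum>i<d * d. 1 / 2 + swap_op d $$ (i, i) / 2)"
    using carrier_matD[OF swap_op_carrier[of d]]
    unfolding tr_def sym_proj_def by (intro sum.cong) (auto simp: algebra_simps)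
  also have "\<dots> = of_nat (d * d) / 2 + tr (swap_op d) / 2"
    using carrier_matD[OF swap_op_carrier[of d]]
    by (simp add: sum.distrib tr_def sum_divide_distrib)
  finally show ?thesis by (simp add: tr_swap_op field_simps)
qed

lemma sym_proj_mult_vec:
  assumes "v \<in> carrier_vec (d * d)"
  shows "sym_proj d *\<^sub>v v = (1 / 2) \<cdot>\<^sub>v (v + swap_op d *\<^sub>v v)"
proof -
  have "sym_proj d *\<^sub>v v = (1 / 2) \<cdot>\<^sub>v ((1\<^sub>m (d * d) + swap_op d) *\<^sub>v v)"
    unfolding sym_proj_def using assms carrier_matD[OF swap_op_carrier[of d]]
    by (intro eq_vecI) auto
  thus ?thesis
    using assms add_mult_distrib_mat_vec[OF one_carrier_mat swap_op_carrier assms] by simp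
qed

lemma tensor_vec_carrier [simp]:
  "\<psi> \<in> carrier_vec m \<Longrightarrow> \<phi> \<in> carrier_vec n \<Longrightarrow> tensor_vec \<psi> \<phi> \<in> carrier_vec (m * n)"
  by (simp add: tensor_vec_def)

lemma sym_proj_tensor_vec:
  assumes "\<psi> \<in> carrier_vec d" "\<phi> \<in> carrier_vec d"
  shows "sym_proj d *\<^sub>v tensor_vec \<psi> \<phi> =
    (1 / 2) \<cdot>\<^sub>v (tensor_vec \<psi> \<phi> + tensor_vec \<phi> \<psi>)"
  using assms by (simp add: sym_proj_mult_vec swap_op_tensor_vec)

text \<open>Applying \<open>A\<close> twice to an eigenvector \<open>v\<close> gives e v = e^2 v;
  comparing a nonzero coordinate forces e = e^2.\<close>

lemma idempotent_energies:
  assumes A: "A \<in> carrier_mat n n" and idem: "A * A = A"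
  shows "energies A \<subseteq> {0, 1}"
proof
  fix e assume "e \<in> energies A"
  then obtain v where v: "v \<in> carrier_vec n" "v \<noteq> 0\<^sub>v n"
    and Av: "A *\<^sub>v v = complex_of_real e \<cdot>\<^sub>v v"
    using A by (auto simp: energies_def eigenvalue_def eigenvector_def)
  obtain i where i: "i < n" "v $ i \<noteq> 0"
    using v by (metis carrier_vecD eq_vecI index_zero_vec(1) index_zero_vec(2))
  have "complex_of_real e \<cdot>\<^sub>v v = A *\<^sub>v (A *\<^sub>v v)"
    using A v idem by (metis Av assoc_mult_mat_vec)
  also have "\<dots> = complex_of_real e \<cdot>\<^sub>v (complex_of_real e \<cdot>\<^sub>v v)"
    using A v by (simp add: Av mult_mat_vec)
  finally have "complex_of_real e * v $ i = complex_of_real e * (complex_of_real e * v $ i)"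
    using i v by (metis carrier_vecD index_smult_vec(1) smult_carrier_vec)
  hence "complex_of_real e = 0 \<or> complex_of_real e = 1" using i by auto
  thus "e \<in> {0, 1}" by simp
qed

lemma energies_sym_proj:
  assumes "d \<ge> 2"
  shows "energies (sym_proj d) = {0, 1}"
proof (rule equalityI)
  show "energies (sym_proj d) \<subseteq> {0, 1}"
    by (rule idempotent_energies[OF sym_proj_carrier sym_proj_idem])
  define e0 e1 :: "complex vec" where "e0 = unit_vec d 0" and "e1 = unit_vec d 1"
  have c: "e0 \<in> carrier_vec d" "e1 \<in> carrier_vec d" by (auto simp: e0_def e1_def)
  have small: "1 < d * d" "0 < d * d" using mult_le_mono[OF assms assms] assms by auto
  \<comment> \<open>A symmetric vector is fixed; its entry at index 0, the position of |0>|0>, shows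
    that it is nonzero.\<close>
  have "eigenvector (sym_proj d) (tensor_vec e0 e0) 1"
  proof -
    have "tensor_vec e0 e0 $ 0 \<noteq> 0\<^sub>v (d * d) $ 0"
      using small assms by (simp add: tensor_vec_def e0_def)
    moreover have "sym_proj d *\<^sub>v tensor_vec e0 e0 = 1 \<cdot>\<^sub>v tensor_vec e0 e0"
      using c by (subst sym_proj_tensor_vec) (auto simp: tensor_vec_def)
    ultimately show ?thesis
      using c carrier_matD[OF sym_proj_carrier[of d]] by (auto simp: eigenvector_def)
  qed
  \<comment> \<open>Both products have the same symmetrization, so their difference is sent to 0. It
    is nonzero at index 1, the position of |0>|1>, because \<open>d >= 2\<close> gives 1 div d = 0
    and 1 mod d = 1.\<close>
  moreover have "eigenvector (sym_proj d) (tensor_vec e0 e1 - tensor_vec e1 e0) 0"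
  proof -
    let ?a = "tensor_vec e0 e1" and ?b = "tensor_vec e1 e0"
    have "(?a - ?b) $ 1 \<noteq> 0\<^sub>v (d * d) $ 1"
      using small assms by (simp add: tensor_vec_def e0_def e1_def)
    moreover have "sym_proj d *\<^sub>v (?a - ?b) = 0 \<cdot>\<^sub>v (?a - ?b)"
    proof -
      have "sym_proj d *\<^sub>v (?a - ?b) = sym_proj d *\<^sub>v ?a - sym_proj d *\<^sub>v ?b"
        using c by (intro mult_minus_distrib_mat_vec[OF sym_proj_carrier]) auto
      also have "\<dots> = 0 \<cdot>\<^sub>v (?a - ?b)"
        unfolding sym_proj_tensor_vec[OF c] sym_proj_tensor_vec[OF c(2) c(1)]
        using c by (auto simp: tensor_vec_def)
      finally show ?thesis .
    qed
    ultimately show ?thesis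
      using c carrier_matD[OF sym_proj_carrier[of d]] by (auto simp: eigenvector_def)
  qed
  ultimately show "{0, 1} \<subseteq> energies (sym_proj d)"
    by (auto simp: energies_def eigenvalue_def)
qed

section \<open>Separable states\<close>

lemma tensor_vec_cscalar_prod:
  assumes "a \<in> carrier_vec m" "c \<in> carrier_vec m" "b \<in> carrier_vec n" "e \<in> carrier_vec n"
  shows "tensor_vec a b \<bullet>c tensor_vec c e = (a \<bullet>c c) * (b \<bullet>c e)"
proof -
  have "tensor_vec a b \<bullet>c tensor_vec c e =
      (\<Sum>k<m * n. a $ (k div n) * b $ (k mod n) * (cnj (c $ (k div n)) * cnj (e $ (k mod n))))"
    using assms by (simp add: scalar_prod_def tensor_vec_def atLeast0LessThan)
  also have "\<dots> = (\<Sum>i<m. \<Sum>j<n. a $ i * b $ j * (cnj (c $ i) * cnj (e $ j)))"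
    by (rule sum_div_mod)
  also have "\<dots> = (\<Sum>i<m. a $ i * cnj (c $ i)) * (\<Sum>j<n. b $ j * cnj (e $ j))"
    by (simp add: sum_product mult_ac)
  also have "\<dots> = (a \<bullet>c c) * (b \<bullet>c e)"
    using assms by (simp add: scalar_prod_def atLeast0LessThan)
  finally show ?thesis .
qed

text \<open>By linearity and tr(A |v><v|) = <v|A v>, where \<open>\<bullet>c\<close> conjugates its
  second argument. The energy of a separable state thereby becomes an average of expectations on
  product vectors.\<close>

lemma tr_mult_mixture:
  assumes A: "A \<in> carrier_mat n n" and v: "\<And>k. k < N \<Longrightarrow> v k \<in> carrier_vec n"
  shows "tr (A * mat n n (\<lambda>(r, c). \<Sum>k<N. p k * rank1_proj (v k) $$ (r, c))) =
    (\<Sum>k<N. p k * ((A *\<^sub>v v k) \<bullet>c v k))"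
proof -
  have rank1: "rank1_proj (v k) $$ (r, c) = v k $ r * cnj (v k $ c)"
    if "k < N" "r < n" "c < n" for k r c
    using carrier_vecD[OF v[OF that(1)]] that by (simp add: rank1_proj_def)
  have "tr (A * mat n n (\<lambda>(r, c). \<Sum>k<N. p k * rank1_proj (v k) $$ (r, c))) =
      (\<Sum>i<n. \<Sum>j<n. \<Sum>k<N. A $$ (i, j) * (p k * (v k $ j * cnj (v k $ i))))"
    unfolding tr_def using A rank1
    by (auto simp: scalar_prod_def atLeast0LessThan sum_distrib_left intro!: sum.cong)
  \<comment> \<open>The sum over the mixture is moved outward in two exchanges, first past
    \<open>j\<close>, then past \<open>i\<close>.\<close>
  also have "\<dots> = (\<Sum>i<n. \<Sum>k<N. \<Sum>j<n. A $$ (i, j) * (p k * (v k $ j * cnj (v k $ i))))"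
    by (intro sum.cong refl sum.swap)
  also have "\<dots> = (\<Sum>k<N. \<Sum>i<n. \<Sum>j<n. A $$ (i, j) * (p k * (v k $ j * cnj (v k $ i))))"
    by (rule sum.swap)
  also have "\<dots> = (\<Sum>k<N. p k * ((A *\<^sub>v v k) \<bullet>c v k))"
  proof (rule sum.cong[OF refl])
    fix k assume "k \<in> {..<N}"
    hence "dim_vec (v k) = n" using v by (auto simp: carrier_vecD)
    hence "(A *\<^sub>v v k) \<bullet>c v k = (\<Sum>i<n. (\<Sum>j<n. A $$ (i, j) * v k $ j) * cnj (v k $ i))"
      using A by (simp add: scalar_prod_def atLeast0LessThan)
    thus "(\<Sum>i<n. \<Sum>j<n. A $$ (i, j) * (p k * (v k $ j * cnj (v k $ i)))) =
        p k * ((A *\<^sub>v v k) \<bullet>c v k)"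
      by (simp add: sum_distrib_left sum_distrib_right mult_ac)
  qed
  finally show ?thesis .
qed

text \<open>The identity part contributes the squared norm 1, and the swap part contributes
  <psi|phi><phi|psi>, the squared modulus of the overlap.\<close>

lemma sym_proj_expectation:
  assumes "\<psi> \<in> unit_vecs d" "\<phi> \<in> unit_vecs d"
  shows "(sym_proj d *\<^sub>v tensor_vec \<psi> \<phi>) \<bullet>c tensor_vec \<psi> \<phi> =
    complex_of_real ((1 + (cmod (\<psi> \<bullet>c \<phi>))\<^sup>2) / 2)"
proof -
  have c: "\<psi> \<in> carrier_vec d" "\<phi> \<in> carrier_vec d" and n: "\<psi> \<bullet>c \<psi> = 1" "\<phi> \<bullet>c \<phi> = 1"
    using assms by (auto simp: unit_vecs_def)
  have cj: "\<phi> \<bullet>c \<psi> = cnj (\<psi> \<bullet>c \<phi>)"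
    using c by (simp add: scalar_prod_def mult.commute)
  have t: "tensor_vec \<psi> \<phi> \<in> carrier_vec (d * d)" "tensor_vec \<phi> \<psi> \<in> carrier_vec (d * d)"
    using c by auto
  have "(sym_proj d *\<^sub>v tensor_vec \<psi> \<phi>) \<bullet>c tensor_vec \<psi> \<phi> =
      (1 / 2) * (tensor_vec \<psi> \<phi> \<bullet>c tensor_vec \<psi> \<phi> + tensor_vec \<phi> \<psi> \<bullet>c tensor_vec \<psi> \<phi>)"
    using c t
    by (simp add: sym_proj_tensor_vec add_scalar_prod_distrib[where n = "d * d"]
        smult_scalar_prod_distrib[where n = "d * d"])
  also have "\<dots> = (1 / 2) * (1 + (\<psi> \<bullet>c \<phi>) * cnj (\<psi> \<bullet>c \<phi>))"
    using c by (simp add: tensor_vec_cscalar_prod n cj mult.commute)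
  also have "\<dots> = complex_of_real ((1 + (cmod (\<psi> \<bullet>c \<phi>))\<^sup>2) / 2)"
    by (simp only: complex_norm_square[symmetric]) simp
  finally show ?thesis .
qed

lemma E_sep_sym_proj:
  assumes "d \<ge> 2"
  shows "E_sep d d (sym_proj d) = 1 / 2"
  unfolding E_sep_def
proof (rule Least_equality)
  \<comment> \<open>Two orthogonal unit vectors, available since \<open>d >= 2\<close>, make the
    overlap vanish. The state is written as a mixture with one term so that it has the form used in
    \<open>separable_states\<close> and in \<open>tr_mult_mixture\<close>.\<close>
  let ?e0 = "unit_vec d 0 :: complex vec" and ?e1 = "unit_vec d 1 :: complex vec"
  let ?v = "tensor_vec ?e0 ?e1"
  let ?\<rho> = "mat (d * d) (d * d)
    (\<lambda>(r, c). \<Sum>k<1::nat. complex_of_real 1 * rank1_proj ?v $$ (r, c))"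
  have u: "?e0 \<in> unit_vecs d" "?e1 \<in> unit_vecs d" and orth: "?e0 \<bullet>c ?e1 = 0"
    using assms by (auto simp: unit_vecs_def scalar_prod_left_unit[where n = d])
  have "?\<rho> \<in> separable_states d d"
    unfolding separable_states_def using u
    by (intro CollectI exI[of _ "1::nat"] exI[of _ "\<lambda>_. 1"] exI[of _ "\<lambda>_. ?e0"]
        exI[of _ "\<lambda>_. ?e1"] conjI) auto
  moreover have "tr (sym_proj d * ?\<rho>) = complex_of_real (1 / 2)"
  proof -
    have "tr (sym_proj d * ?\<rho>) =
        (\<Sum>k<1::nat. complex_of_real 1 * ((sym_proj d *\<^sub>v ?v) \<bullet>c ?v))"
      by (rule tr_mult_mixture) auto
    thus ?thesis using sym_proj_expectation[OF u] by (simp add: orth del: One_nat_def)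
  qed
  ultimately show "\<exists>\<rho>\<in>separable_states d d. 1 / 2 = Re (tr (sym_proj d * \<rho>))"
    by (intro bexI[of _ ?\<rho>]) (simp_all only: Re_complex_of_real)
next
  fix e assume "\<exists>\<rho>\<in>separable_states d d. e = Re (tr (sym_proj d * \<rho>))"
  then obtain N :: nat and p :: "nat \<Rightarrow> real" and \<psi> \<phi> where
    pos: "\<And>k. k < N \<Longrightarrow> 0 \<le> p k" and
    u: "\<And>k. k < N \<Longrightarrow> \<psi> k \<in> unit_vecs d" "\<And>k. k < N \<Longrightarrow> \<phi> k \<in> unit_vecs d" and
    one: "(\<Sum>k<N. p k) = 1" and
    e: "e = Re (tr (sym_proj d * mat (d * d) (d * d) (\<lambda>(r, c). \<Sum>k<N. complex_of_real (p k) *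
                 rank1_proj (tensor_vec (\<psi> k) (\<phi> k)) $$ (r, c))))"
    unfolding separable_states_def by blast
  have "e = Re (\<Sum>k<N. complex_of_real (p k) *
      ((sym_proj d *\<^sub>v tensor_vec (\<psi> k) (\<phi> k)) \<bullet>c tensor_vec (\<psi> k) (\<phi> k)))"
    unfolding e using u by (subst tr_mult_mixture) (auto simp: unit_vecs_def)
  also have "\<dots> = (\<Sum>k<N. p k * ((1 + (cmod (\<psi> k \<bullet>c \<phi> k))\<^sup>2) / 2))"
    unfolding Re_sum using u by (intro sum.cong) (auto simp: sym_proj_expectation)
  \<comment> \<open>Dropping the nonnegative squared overlaps leaves 1/2 in every term, and the
    weights sum to 1.\<close>
  also have "\<dots> \<ge> (\<Sum>k<N. p k * (1 / 2))"
    using pos by (intro sum_mono mult_left_mono) auto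
  also have "(\<Sum>k<N. p k * (1 / 2)) = 1 / 2"
    using one by (simp flip: sum_divide_distrib)
  finally show "1 / 2 \<le> e" .
qed

section \<open>Thermal states of idempotent Hamiltonians\<close>

text \<open>The exponent is a successor because the zeroth power is the identity, not a multiple of
  \<open>A\<close>.\<close>

lemma pow_mat_smult_idempotent:
  fixes A :: "'a::comm_semiring_1 mat"
  assumes A: "A \<in> carrier_mat n n" and idem: "A * A = A"
  shows "(c \<cdot>\<^sub>m A) ^\<^sub>m Suc k = c ^ Suc k \<cdot>\<^sub>m A"
proof (induction k)
  case 0
  thus ?case using A by simp
next
  case (Suc k)
  have "(c \<cdot>\<^sub>m A) ^\<^sub>m Suc (Suc k) = (c ^ Suc k \<cdot>\<^sub>m A) * (c \<cdot>\<^sub>m A)"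
    using Suc.IH by simp
  also have "\<dots> = c ^ Suc k \<cdot>\<^sub>m (c \<cdot>\<^sub>m (A * A))"
    using mult_smult_assoc_mat[OF A smult_carrier_mat[OF A]] mult_smult_distrib[OF A A] by metis
  also have "\<dots> = c ^ Suc (Suc k) \<cdot>\<^sub>m A"
    using A by (intro eq_matI) (auto simp: idem mult_ac)
  finally show ?case .
qed

text \<open>Every term of the series with k >= 1 is a scalar multiple of \<open>A\<close>, and these
  scalars add up to e^c - 1; the term k = 0 supplies the identity.\<close>

lemma mat_exp_smult_idempotent:
  assumes A: "A \<in> carrier_mat n n" and idem: "A * A = A"
  shows "mat_exp (c \<cdot>\<^sub>m A) = 1\<^sub>m n + (exp c - 1) \<cdot>\<^sub>m A"
proof (rule eq_matI)
  fix i j assume "i < dim_row (1\<^sub>m n + (exp c - 1) \<cdot>\<^sub>m A)" "j < dim_col (1\<^sub>m n + (exp c - 1) \<cdot>\<^sub>m A)"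
  hence ij: "i < n" "j < n" using A by auto
  let ?f = "\<lambda>k. ((c \<cdot>\<^sub>m A) ^\<^sub>m k) $$ (i, j) / fact k"
  have "(\<lambda>k. c ^ k / fact k) sums exp c"
    using exp_converges[of c] by (simp add: scaleR_conv_of_real field_simps)
  hence "(\<lambda>k. c ^ Suc k / fact (Suc k)) sums (exp c - 1)"
    by (subst sums_Suc_iff) simp
  hence "(\<lambda>k. c ^ Suc k / fact (Suc k) * A $$ (i, j)) sums ((exp c - 1) * A $$ (i, j))"
    by (rule sums_mult2)
  moreover have "?f (Suc k) = c ^ Suc k / fact (Suc k) * A $$ (i, j)" for k
    using A ij by (simp only: pow_mat_smult_idempotent[OF A idem]) simp
  ultimately have "(\<lambda>k. ?f (Suc k)) sums ((exp c - 1) * A $$ (i, j))" by (simp only:)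
  \<comment> \<open>The term for k = 0, an entry of the identity matrix, is put back in front of the
    shifted series.\<close>
  hence "?f sums ((exp c - 1) * A $$ (i, j) + ?f 0)"
    by (rule sums_Suc)
  hence "suminf ?f = (exp c - 1) * A $$ (i, j) + ?f 0"
    by (rule sums_unique[symmetric])
  thus "mat_exp (c \<cdot>\<^sub>m A) $$ (i, j) = (1\<^sub>m n + (exp c - 1) \<cdot>\<^sub>m A) $$ (i, j)"
    using A ij by (simp add: mat_exp_def)
qed (use A in \<open>auto simp: mat_exp_def\<close>)

lemma tr_add:
  "A \<in> carrier_mat n n \<Longrightarrow> B \<in> carrier_mat n n \<Longrightarrow> tr (A + B) = tr A + tr B"
  by (simp add: tr_def sum.distrib)

lemma tr_smult: "A \<in> carrier_mat n n \<Longrightarrow> tr (c \<cdot>\<^sub>m A) = c * tr A"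
  by (simp add: tr_def sum_distrib_left)

text \<open>With W = I + (x - 1)A, idempotence gives A W = x A, of trace x t, while tr W = n - t + x
  t is the partition function: weight 1 on the kernel of \<open>A\<close> and weight x on its
  range.\<close>

lemma thermal_energy_idempotent:
  fixes kB T :: real
  assumes A: "A \<in> carrier_mat n n" and idem: "A * A = A" and t: "tr A = complex_of_real t"
  defines "x \<equiv> exp (- (1 / (kB * T)))"
  shows "thermal_energy kB A T = x * t / (real n - t + x * t)"
proof -
  let ?c = "complex_of_real (- (1 / (kB * T)))"
  let ?W = "1\<^sub>m n + (exp ?c - 1) \<cdot>\<^sub>m A"
  have W: "?W \<in> carrier_mat n n" using A by simp
  have x: "exp ?c = complex_of_real x" unfolding x_def by (rule exp_of_real)
  have trW: "tr ?W = complex_of_real (real n - t + x * t)"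
    using A by (simp add: tr_add[of _ n] tr_smult[of _ n] t x tr_def[of "1\<^sub>m n"] left_diff_distrib
        del: of_real_minus)
  have "A * ?W = A * 1\<^sub>m n + A * ((exp ?c - 1) \<cdot>\<^sub>m A)"
    using A by (intro mult_add_distrib_mat) auto
  also have "\<dots> = A + (exp ?c - 1) \<cdot>\<^sub>m A"
    using A by (simp add: mult_smult_distrib[of _ n n _ n] idem)
  finally have "tr (A * ?W) = complex_of_real (x * t)"
    using A by (simp add: tr_add[of _ n] tr_smult[of _ n] t x left_diff_distrib del: of_real_minus)
  moreover have "A * thermal_state kB A T = (1 / tr ?W) \<cdot>\<^sub>m (A * ?W)"
    unfolding thermal_state_def Let_def mat_exp_smult_idempotent[OF A idem]
    using A W by (rule mult_smult_distrib)
  ultimately have "tr (A * thermal_state kB A T) =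
      complex_of_real (x * t / (real n - t + x * t))"
    using A W by (simp add: tr_smult[of _ n] trW del: of_real_minus)
  thus ?thesis by (simp add: thermal_energy_def)
qed

section \<open>The entanglement-gap temperature\<close>

text \<open>An equivalence, rather than a mere verification of the solution, yields existence and
  uniqueness together and so evaluates the \<open>THE\<close> in
  \<open>ent_gap_temp\<close>.\<close>

lemma is_ent_gap_temp_sym_proj_iff:
  assumes "kB > 0" "d \<ge> 2"
  shows "is_ent_gap_temp kB d d (sym_proj d) T \<longleftrightarrow>
    T = inverse (ln ((real d + 1) / (real d - 1))) / kB"
proof -
  define L where "L = ln ((real d + 1) / (real d - 1))"
  have L: "L > 0" using assms by (simp add: L_def)
  define x where "x = exp (- (1 / (kB * T)))"
  have x: "x > 0" by (simp add: x_def)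
  define t where "t = real d * (real d + 1) / 2"
  have "tr (sym_proj d) = complex_of_real t" by (simp add: tr_sym_proj t_def distrib_left)
  hence U: "thermal_energy kB (sym_proj d) T = x * t / (real (d * d) - t + x * t)"
    unfolding x_def by (intro thermal_energy_idempotent sym_proj_idem) auto
  \<comment> \<open>This is the dimension of the antisymmetric subspace. Its positivity for
    \<open>d >= 2\<close> makes the partition function positive, so that the denominator can be
    cleared.\<close>
  have nt: "real (d * d) - t = real d * (real d - 1) / 2"
    by (simp add: t_def field_simps)
  have "real (d * d) - t > 0" "t > 0" using assms by (auto simp: nt t_def)
  hence "real (d * d) - t + x * t > 0" using x by (simp add: add_pos_pos)
  hence "thermal_energy kB (sym_proj d) T = 1 / 2 \<longleftrightarrow> x * t = real (d * d) - t"
    unfolding U by (auto simp: field_simps)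
  also have "\<dots> \<longleftrightarrow> real d * (x * (real d + 1)) = real d * (real d - 1)"
    unfolding nt t_def by (auto simp: field_simps)
  also have "\<dots> \<longleftrightarrow> x = (real d - 1) / (real d + 1)"
    using assms by (subst mult_cancel_left) (simp add: field_simps)
  \<comment> \<open>Writing the ratio as a Boltzmann factor lets injectivity of exp identify the
    inverse temperature with \<open>L\<close>.\<close>
  also have "(real d - 1) / (real d + 1) = exp (- L)"
    using assms by (simp add: L_def exp_minus)
  also have "x = exp (- L) \<longleftrightarrow> 1 / (kB * T) = L"
    by (simp add: x_def)
  finally have "is_ent_gap_temp kB d d (sym_proj d) T \<longleftrightarrow> 0 < T \<and> 1 / (kB * T) = L"
    using assms by (simp add: is_ent_gap_temp_def E_sep_sym_proj)
  also have "\<dots> \<longleftrightarrow> T = inverse L / kB"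
  proof
    assume "0 < T \<and> 1 / (kB * T) = L"
    thus "T = inverse L / kB" using assms by (auto simp: field_simps)
  next
    assume "T = inverse L / kB"
    thus "0 < T \<and> 1 / (kB * T) = L" using assms L by (simp add: divide_inverse)
  qed
  finally show ?thesis by (simp add: L_def)
qed

lemma E_tot_sym_proj: "d \<ge> 2 \<Longrightarrow> E_tot (sym_proj d) = 1"
  by (simp add: E_tot_def E_max_def E_min_def energies_sym_proj)

lemma ent_gap_sym_proj: "d \<ge> 2 \<Longrightarrow> ent_gap d d (sym_proj d) = 1 / 2"
  by (simp add: ent_gap_def E_min_def energies_sym_proj E_sep_sym_proj)

lemma scaled_ent_gap_temp_sym_proj:
  assumes "kB > 0" "d \<ge> 2"
  shows "scaled_ent_gap_temp kB d d (sym_proj d) = inverse (ln ((real d + 1) / (real d - 1)))"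
  using assms
  by (simp add: scaled_ent_gap_temp_def ent_gap_temp_def E_tot_sym_proj
      is_ent_gap_temp_sym_proj_iff[OF assms])

text \<open>Growth without bound is expressed by strict monotonicity from d = 2 on together with
  divergence; the unique existence of T ensures that the scaled temperature refers to an actual
  solution.\<close>

theorem mainTheorem5:
  fixes kB :: real
  assumes "kB > 0"
  shows "(\<forall>d::nat. d \<ge> 2 \<longrightarrow>
            E_tot (sym_proj d) = 1 \<and>
            ent_gap d d (sym_proj d) = 1 / 2 \<and>
            (\<exists>!T. is_ent_gap_temp kB d d (sym_proj d) T) \<and>
            scaled_ent_gap_temp kB d d (sym_proj d) =
              inverse (ln ((real d + 1) / (real d - 1)))) \<and>
         (\<lambda>d. scaled_ent_gap_temp kB d d (sym_proj d)) \<sim>[sequentially] (\<lambda>d. real d / 2) \<and>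
         strict_mono_on {2..} (\<lambda>d. scaled_ent_gap_temp kB d d (sym_proj d)) \<and>
         filterlim (\<lambda>d. scaled_ent_gap_temp kB d d (sym_proj d)) at_top sequentially"
proof -
  let ?t = "\<lambda>d. scaled_ent_gap_temp kB d d (sym_proj d)"
  let ?g = "\<lambda>d::nat. inverse (ln ((real d + 1) / (real d - 1)))"
  \<comment> \<open>The closed form is available only from d = 2 on, so limits are transferred along
    eventual equality.\<close>
  have ev: "eventually (\<lambda>d. ?g d = ?t d) sequentially"
    using eventually_ge_at_top[of 2]
    by eventually_elim (simp add: scaled_ent_gap_temp_sym_proj[OF assms])
  \<comment> \<open>The logarithm equals ln(1 + 2/(d - 1)), which behaves like 2/d.\<close>
  have "?g \<sim>[sequentially] (\<lambda>d. real d / 2)" by real_asymp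
  hence "?t \<sim>[sequentially] (\<lambda>d. real d / 2)"
    by (rule asymp_equiv_cong[OF ev always_eventually, THEN iffD1, rotated]) simp
  moreover have "filterlim ?g at_top sequentially" by real_asymp
  hence "filterlim ?t at_top sequentially"
    using filterlim_cong[OF refl refl ev] by blast
  moreover have "strict_mono_on {2..} ?t"
  proof (rule strict_mono_onI)
    fix r s :: nat assume "r \<in> {2..}" "s \<in> {2..}" "r < s"
    hence rs: "r \<ge> 2" "s \<ge> 2" "r < s" by auto
    \<comment> \<open>The ratio is 1 + 2/(d - 1), hence decreasing in d and above 1. Its logarithm
      is therefore decreasing and positive, and the inverse reverses the order.\<close>
    have "(real s + 1) / (real s - 1) < (real r + 1) / (real r - 1)"
      using rs by (simp add: field_simps)
    hence "ln ((real s + 1) / (real s - 1)) < ln ((real r + 1) / (real r - 1))"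
      using rs by (subst ln_less_cancel_iff) auto
    moreover have "0 < ln ((real s + 1) / (real s - 1))" using rs by simp
    ultimately show "?t r < ?t s"
      using rs by (simp add: scaled_ent_gap_temp_sym_proj[OF assms])
  qed
  ultimately show ?thesis
    using assms
    by (auto simp: E_tot_sym_proj ent_gap_sym_proj scaled_ent_gap_temp_sym_proj
        is_ent_gap_temp_sym_proj_iff)
qed

end
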